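(* Let the parameters be pairs $(\beta_i,\gamma_i)$ of complex numbers with $\gamma_i^2-\beta_i^2=1$, and define the map $R(\beta_1,\beta_2):(x,y)\mapsto(p,q)$ by $$(p^1,p^2)=(y^1P^{-1},\;y^2P^{-1}),\qquad (q^1,q^2)=(x^1P,\;x^2Q),$$ $$P=\frac{(\beta_1-\beta_2)y^2+\gamma_2+\gamma_1x^1y^2}{(\beta_1-\beta_2)x^1+\gamma_1+\gamma_2x^1y^2},\qquad Q=\frac{(\beta_2-\beta_1)\frac{x^1y^2}{x^2}+\gamma_2+\gamma_1x^1y^2}{(\beta_2-\beta_1)x^2+\gamma_1+\gamma_2x^1y^2}.$$ Then: (a) whenever $u,v,u_{(1)},u_{(2)},v_{(2)},u_{(1,2)},v_{(1,2)}$ satisfy $$u_{(1,2)}=\frac{(\beta_1-\beta_2)u_{(1)}v_{(2)}+u(\gamma_2u_{(1)}+\gamma_1v_{(2)})}{(\beta_1-\beta_2)u+\gamma_1u_{(1)}+\gamma_2v_{(2)}},\qquad v_{(1,2)}=\frac{(\beta_2-\beta_1)u_{(1)}v_{(2)}+v(\gamma_1v_{(2)}+\gamma_2u_{(1)})}{(\beta_2-\beta_1)v+\gamma_2v_{(2)}+\gamma_1u_{(1)}},$$ the quantities $x=(u/u_{(1)},\,v/u_{(1)})$, $y=(u_{(2)}/u,\,v_{(2)}/u)$, $p=(u_{(2)}/u_{(1,2)},\,v_{(2)}/u_{(1,2)})$, $q=(u_{(1,2)}/u_{(1)},\,v_{(1,2)}/u_{(1)})$ satisfy $(p,q)=R(\beta_1,\beta_2)(x,y)$;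 (b) $R$ satisfies the parameter-dependent Yang-Baxter relation $$R^{(2,3)}(\beta_2,\beta_3)\,R^{(1,3)}(\beta_1,\beta_3)\,R^{(1,2)}(\beta_1,\beta_2)=R^{(1,2)}(\beta_1,\beta_2)\,R^{(1,3)}(\beta_1,\beta_3)\,R^{(2,3)}(\beta_2,\beta_3).$$
   Context: $R(\beta_i,\beta_j)$ is shorthand for the map depending on the pairs $(\beta_i,\gamma_i)$ and $(\beta_j,\gamma_j)$, obtained by replacing indices $1,2$ of the parameters by $i,j$; the same $\gamma_i$ is used with $\beta_i$ throughout. Here $x=(x^1,x^2)$, etc.; upper indices on $x,y,p,q$ denote components, not powers (except $P^{-1}=1/P$; $\gamma_i^2,\beta_i^2$ are squares). All variables are complex scalars; identities are understood for generic values, where all expressions are defined (equalities of rational maps). $R^{(i,j)}$ acts on triples $(x,y,z)$ of elements of $\mathbb{C}^2$ as $R$ on the $i$-th and $j$-th entries (in this order) and as the identity on the remaining entry; products are compositions. Subscripts in parentheses are just names for the (shifted) field values on the vertices of an elementary square. *)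

theory Defs
  imports "HOL-Analysis.Analysis"
begin

text \<open>
  A parameter is a pair \<open>(\<beta>, \<gamma>)\<close>; a field value is a pair of components
  \<open>x = (x\<^sup>1, x\<^sup>2)\<close>, written \<open>(x1, x2)\<close>.
\<close>

type_synonym param = "complex \<times> complex"
type_synonym point = "complex \<times> complex"

definition admissible :: "param \<Rightarrow> bool" where
  "admissible = (\<lambda>(\<beta>, \<gamma>). \<gamma>\<^sup>2 - \<beta>\<^sup>2 = 1)"

fun P_num :: "param \<Rightarrow> param \<Rightarrow> point \<Rightarrow> point \<Rightarrow> complex" where
  "P_num (\<beta>1, \<gamma>1) (\<beta>2, \<gamma>2) (x1, x2) (y1, y2) = (\<beta>1 - \<beta>2) * y2 + \<gamma>2 + \<gamma>1 * x1 * y2"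

fun P_den :: "param \<Rightarrow> param \<Rightarrow> point \<Rightarrow> point \<Rightarrow> complex" where
  "P_den (\<beta>1, \<gamma>1) (\<beta>2, \<gamma>2) (x1, x2) (y1, y2) = (\<beta>1 - \<beta>2) * x1 + \<gamma>1 + \<gamma>2 * x1 * y2"

fun Q_num :: "param \<Rightarrow> param \<Rightarrow> point \<Rightarrow> point \<Rightarrow> complex" where
  "Q_num (\<beta>1, \<gamma>1) (\<beta>2, \<gamma>2) (x1, x2) (y1, y2) =
     (\<beta>2 - \<beta>1) * (x1 * y2 / x2) + \<gamma>2 + \<gamma>1 * x1 * y2"

fun Q_den :: "param \<Rightarrow> param \<Rightarrow> point \<Rightarrow> point \<Rightarrow> complex" where
  "Q_den (\<beta>1, \<gamma>1) (\<beta>2, \<gamma>2) (x1, x2) (y1, y2) = (\<beta>2 - \<beta>1) * x2 + \<gamma>1 + \<gamma>2 * x1 * y2"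

text \<open>
  The rational map \<open>R\<close> is modelled as a partial map, with value \<open>None\<close> exactly where one of the
  divisions in its defining formulas (by \<open>x\<^sup>2\<close>, by the denominators of \<open>P\<close> and \<open>Q\<close>, and by \<open>P\<close>
  itself) is a division by zero; in particular \<open>a / 0 = 0\<close> is never used.
\<close>

definition R :: "param \<Rightarrow> param \<Rightarrow> point \<times> point \<rightharpoonup> point \<times> point" where
  "R a b = (\<lambda>(x, y).
     let P = P_num a b x y / P_den a b x y;
         Q = Q_num a b x y / Q_den a b x y
     in if snd x \<noteq> 0 \<and> P_den a b x y \<noteq> 0 \<and> Q_den a b x y \<noteq> 0 \<and> P \<noteq> 0
        then Some ((fst y * inverse P, snd y * inverse P), (fst x * P, snd x * Q))
        else None)"

definition on12 :: "(point \<times> point \<rightharpoonup> point \<times> point) \<Rightarrow>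
    (point \<times> point \<times> point \<rightharpoonup> point \<times> point \<times> point)" where
  "on12 f = (\<lambda>(x, y, z). map_option (\<lambda>(p, q). (p, q, z)) (f (x, y)))"

definition on13 :: "(point \<times> point \<rightharpoonup> point \<times> point) \<Rightarrow>
    (point \<times> point \<times> point \<rightharpoonup> point \<times> point \<times> point)" where
  "on13 f = (\<lambda>(x, y, z). map_option (\<lambda>(p, q). (p, y, q)) (f (x, z)))"

definition on23 :: "(point \<times> point \<rightharpoonup> point \<times> point) \<Rightarrow>
    (point \<times> point \<times> point \<rightharpoonup> point \<times> point \<times> point)" where
  "on23 f = (\<lambda>(x, y, z). map_option (\<lambda>(p, q). (x, p, q)) (f (y, z)))"

text \<open>
  The two sides of the Yang-Baxter relation. The library composition \<open>f \<circ>\<^sub>m g\<close> of partial maps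
  applies \<open>g\<close> first.
\<close>

definition YB_lhs :: "param \<Rightarrow> param \<Rightarrow> param \<Rightarrow>
    (point \<times> point \<times> point \<rightharpoonup> point \<times> point \<times> point)" where
  "YB_lhs a b c = on23 (R b c) \<circ>\<^sub>m (on13 (R a c) \<circ>\<^sub>m on12 (R a b))"

definition YB_rhs :: "param \<Rightarrow> param \<Rightarrow> param \<Rightarrow>
    (point \<times> point \<times> point \<rightharpoonup> point \<times> point \<times> point)" where
  "YB_rhs a b c = on12 (R a b) \<circ>\<^sub>m (on13 (R a c) \<circ>\<^sub>m on23 (R b c))"

text \<open>
  For admissible parameters, the formula for \<open>P\<close> reads \<open>0 / 0\<close> identically in \<open>x\<close> and \<open>y\<close> iff
  \<open>\<beta>1 = \<beta>2\<close> and \<open>\<gamma>1 = \<gamma>2 = 0\<close> (that is, \<open>\<beta>1 = \<beta>2 = \<plusminus>\<i>\<close>); such a pair of parameters does not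
  define a rational map.
\<close>

definition nondegenerate :: "param \<Rightarrow> param \<Rightarrow> bool" where
  "nondegenerate = (\<lambda>(\<beta>1, \<gamma>1) (\<beta>2, \<gamma>2). \<not> (\<beta>1 = \<beta>2 \<and> \<gamma>1 = 0 \<and> \<gamma>2 = 0))"

end

theory Submission
  imports Defs
begin

text \<open>
  Write \<open>s\<close> for the product of \<open>x\<^sup>1\<close> and \<open>y\<^sup>2\<close>, and \<open>\<delta>\<close> for \<open>\<beta>1 - \<beta>2\<close>. The first component
  of \<open>q\<close> is a Moebius transform of \<open>x\<^sup>1\<close>, the second one a Moebius transform of \<open>x\<^sup>2\<close>. The
  matrices are \<open>((\<gamma>2 + \<gamma>1 s, \<delta> s), (\<delta>, \<gamma>1 + \<gamma>2 s))\<close> and the same with \<open>-\<delta>\<close> for \<open>\<delta>\<close>; they depend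
  on \<open>x\<close> and \<open>y\<close> through \<open>s\<close> alone. In the field variables these two transforms are the equations
  of the elementary square, which is (a).

  For the Yang-Baxter relation, read the entries of a triple as the edges of a path with four
  vertices that carry field values as in (a): the \<open>u\<close>-value at the start is \<open>1\<close>, the first interior
  vertex has \<open>u\<close>- and \<open>v\<close>-values \<open>x\<^sup>1\<close> and \<open>x\<^sup>2\<close>, and so on. Each of the six maps changes the
  values at one interior vertex, by Moebius transformations whose matrices depend only on the
  \<open>u\<close>-value before and the \<open>v\<close>-value after that vertex. On the left side the first interior vertex
  is changed by the matrix \<open>M12\<close> and then by \<open>M23\<close>, the second one by \<open>M13\<close> in between; on the
  right side the first one is changed by \<open>M13\<close> alone, and the second one by \<open>M23\<close> and then \<open>M12\<close>.
  At the arguments that occur, and up to the denominators of these arguments, the relations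
  between \<open>\<gamma>\<close> and \<open>\<beta>\<close> imply that \<open>M23 M12\<close> is \<open>det M12\<close> times \<open>M13\<close> at the first vertex
  (\<open>product_23_12\<close>), and that \<open>M12 M23\<close> is \<open>det M23\<close> times \<open>M13\<close> at the second one
  (\<open>product_12_23\<close>). If one of these determinants vanished, a denominator on the side with two
  transformations would vanish too; so wherever both sides are defined the factor cancels, and the
  sides agree (\<open>YB_sides_agree\<close>).

  The common domain is open and dense because each \<open>R\<close> has an open domain on which it is
  continuous, and is injective on an open dense part of it, where the determinant of its matrices
  is nonzero (\<open>generic_embedding_R\<close>). By invariance of domain the preimages of open dense sets
  under such a map are open and dense again, so the property passes to compositions
  (\<open>generic_embedding_map_comp\<close>).
\<close>

section \<open>The map as a pair of Moebius transformations\<close>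

text \<open>
  In \<open>q2_fun\<close> the arguments \<open>s\<close> and \<open>v\<close> stand for \<open>x\<^sup>1 y\<^sup>2\<close> and \<open>x\<^sup>2\<close>, and the value for the
  second component of \<open>q\<close>, that is, for \<open>x\<^sup>2 Q\<close>: unlike \<open>Q\<close> itself it has no inner division by
  \<open>x\<^sup>2\<close> and is visibly a Moebius transform of \<open>v\<close>.
\<close>

definition P_fun :: "'a::field \<Rightarrow> 'a \<Rightarrow> 'a \<Rightarrow> 'a \<Rightarrow> 'a \<Rightarrow> 'a" where
  "P_fun \<delta> k l x y = (\<delta> * y + l + k * (x * y)) / (\<delta> * x + k + l * (x * y))"

definition q2_fun :: "'a::field \<Rightarrow> 'a \<Rightarrow> 'a \<Rightarrow> 'a \<Rightarrow> 'a \<Rightarrow> 'a" where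
  "q2_fun \<delta> k l s v = (v * (l + k * s) - \<delta> * s) / (k + l * s - \<delta> * v)"

lemma R_eq:
  "R (a, k) (b, l) ((x1, x2), (y1, y2)) =
    (let P = P_fun (a - b) k l x1 y2 in
     if x2 \<noteq> 0 \<and> (a - b) * x1 + k + l * (x1 * y2) \<noteq> 0 \<and> k + l * (x1 * y2) - (a - b) * x2 \<noteq> 0 \<and> P \<noteq> 0
     then Some ((y1 / P, y2 / P), (x1 * P, q2_fun (a - b) k l (x1 * y2) x2)) else None)"
proof (cases "x2 = 0")
  case True
  then show ?thesis by (simp add: R_def Let_def)
next
  case False
  have pden: "P_den (a, k) (b, l) (x1, x2) (y1, y2) = (a - b) * x1 + k + l * (x1 * y2)"
    and qden: "Q_den (a, k) (b, l) (x1, x2) (y1, y2) = k + l * (x1 * y2) - (a - b) * x2"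
    by (simp_all add: algebra_simps)
  have P: "P_num (a, k) (b, l) (x1, x2) (y1, y2) / P_den (a, k) (b, l) (x1, x2) (y1, y2)
      = P_fun (a - b) k l x1 y2"
    by (simp add: P_fun_def mult.assoc)
  have "x2 * Q_num (a, k) (b, l) (x1, x2) (y1, y2) = x2 * (l + k * (x1 * y2)) - (a - b) * (x1 * y2)"
    using False by (simp add: field_simps)
  then have Q: "x2 * (Q_num (a, k) (b, l) (x1, x2) (y1, y2) / Q_den (a, k) (b, l) (x1, x2) (y1, y2)) =
      q2_fun (a - b) k l (x1 * y2) x2"
    unfolding qden q2_fun_def by simp
  show ?thesis
    using False unfolding R_def Let_def prod.case fst_conv snd_conv P Q
    unfolding pden qden by (simp add: divide_inverse)
qed

lemma R_SomeD:
  assumes "R (a, k) (b, l) ((x1, x2), (y1, y2)) = Some r" and "P = P_fun (a - b) k l x1 y2"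
  shows "r = ((y1 / P, y2 / P), (x1 * P, q2_fun (a - b) k l (x1 * y2) x2))"
    and "P \<noteq> 0" "(a - b) * x1 + k + l * (x1 * y2) \<noteq> 0" "k + l * (x1 * y2) - (a - b) * x2 \<noteq> 0"
  using assms unfolding R_eq Let_def by (simp_all split: if_splits)

text \<open>The products \<open>s = v2 / u1\<close> and \<open>P = u12 / u\<close> turn the two Moebius transformations into the
  equations of the square, with \<open>u1\<close> as common denominator.\<close>

lemma R_of_square:
  fixes a k b l u v u1 u2 v2 u12 v12 :: complex
  assumes nz: "u \<noteq> 0" "v \<noteq> 0" "u1 \<noteq> 0" "u12 \<noteq> 0"
    and den: "(a - b) * u + k * u1 + l * v2 \<noteq> 0" "(b - a) * v + l * v2 + k * u1 \<noteq> 0"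
    and u12: "u12 = ((a - b) * u1 * v2 + u * (l * u1 + k * v2)) / ((a - b) * u + k * u1 + l * v2)"
    and v12: "v12 = ((b - a) * u1 * v2 + v * (k * v2 + l * u1)) / ((b - a) * v + l * v2 + k * u1)"
  shows "R (a, k) (b, l) ((u / u1, v / u1), (u2 / u, v2 / u))
    = Some ((u2 / u12, v2 / u12), (u12 / u1, v12 / u1))"
proof -
  have s: "u / u1 * (v2 / u) = v2 / u1" using nz by simp
  have Pden: "(a - b) * (u / u1) + k + l * (v2 / u1) = ((a - b) * u + k * u1 + l * v2) / u1"
    and Pnum: "(a - b) * (v2 / u) + l + k * (v2 / u1)
      = ((a - b) * u1 * v2 + u * (l * u1 + k * v2)) / u / u1"
    and Qden: "k + l * (v2 / u1) - (a - b) * (v / u1) = ((b - a) * v + l * v2 + k * u1) / u1"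
    and Qnum: "v / u1 * (l + k * (v2 / u1)) - (a - b) * (v2 / u1)
      = ((b - a) * u1 * v2 + v * (k * v2 + l * u1)) / u1 / u1"
    using nz by (simp_all add: field_simps)
  have P: "P_fun (a - b) k l (u / u1) (v2 / u) = u12 / u"
    unfolding P_fun_def s Pden Pnum u12 using nz by simp
  have Q: "q2_fun (a - b) k l (v2 / u1) (v / u1) = v12 / u1"
    unfolding q2_fun_def Qden Qnum v12 using nz by simp
  show ?thesis
    unfolding R_eq Let_def P s Pden Qden Q using nz den by simp
qed

section \<open>The Yang-Baxter relation\<close>

text \<open>
  The scale is fixed by the first interior vertex of the path: it has values \<open>x\<close> and \<open>v\<close>, and the
  \<open>v\<close>-values at the second interior vertex and at the end are \<open>x y\<close> and \<open>x w\<close>. The \<open>v\<close>-value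
  at the second interior vertex becomes \<open>x N' / D'\<close> after \<open>M13\<close> on the left side, and \<open>x N / D\<close>
  after \<open>M23\<close> on the right side. The first two equations are the components of
  \<open>M23 M12 = det M12 M13\<close> on the vector \<open>(x, 1)\<close>, the last two those on \<open>(v, 1)\<close> with the signs of
  the \<open>\<beta>\<close>-differences reversed. In the first equation a factor \<open>x\<close> is removed from both sides,
  which makes it informative also for \<open>x = 0\<close>.
\<close>

lemma product_23_12:
  fixes a b c k l m x y w n d N' D' N D K v :: "'a::field"
  assumes par: "k\<^sup>2 - a\<^sup>2 = 1" "l\<^sup>2 - b\<^sup>2 = 1" "m\<^sup>2 - c\<^sup>2 = 1"
    and n: "n = (a - b) * y + l + k * (x * y)"
    and d: "d = (a - b) * x + k + l * (x * y)"
    and N': "N' = y * (m * n + k * w * d) - (a - c) * w * n"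
    and D': "D' = k * n + m * w * d - (a - c) * y * d"
    and N: "N = y * (m + l * w) - (b - c) * w"
    and D: "D = l + m * w - (b - c) * y"
    and K: "K = (l + k * (x * y)) * (k + l * (x * y)) - (a - b)\<^sup>2 * (x * y)"
  shows "(m * D' + l * x * N') * n + (b - c) * N' * d = K * (m * D + k * x * N + (a - c) * N)"
    and "(b - c) * x * D' * n + (l * D' + m * x * N') * d
      = K * ((a - c) * x * D + k * D + m * x * N)"
    and "(m * D' + l * x * N') * (v * (l + k * (x * y)) - (a - b) * (x * y))
        - (b - c) * x * N' * (k + l * (x * y) - (a - b) * v)
      = K * (v * (m * D + k * x * N) - (a - c) * x * N)"
    and "(l * D' + m * x * N') * (k + l * (x * y) - (a - b) * v)
        - (b - c) * D' * (v * (l + k * (x * y)) - (a - b) * (x * y))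
      = K * (k * D + m * x * N - (a - c) * D * v)"
  using par unfolding N' D' N D n d K by algebra+

text \<open>
  The mirror image at the second interior vertex, for \<open>M12 M23 = det M23 M13\<close>. On the right
  side the first step multiplies the \<open>u\<close>-value at the second interior vertex by \<open>S / E\<close>, and the
  second step multiplies that at the first one by \<open>r / s\<close>; \<open>N / D\<close> is as before. The first two
  equations concern the \<open>u\<close>-value, the last two the \<open>v\<close>-value.
\<close>

lemma product_12_23:
  fixes a b c k l m x y y1 z2 w n d N D r s S E K :: "'a::field"
  assumes par: "k\<^sup>2 - a\<^sup>2 = 1" "l\<^sup>2 - b\<^sup>2 = 1" "m\<^sup>2 - c\<^sup>2 = 1"
    and w: "w = y1 * z2"
    and n: "n = (a - b) * y + l + k * (x * y)"
    and d: "d = (a - b) * x + k + l * (x * y)"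
    and S: "S = (b - c) * z2 + m + l * w"
    and E: "E = (b - c) * y1 + l + m * w"
    and N: "N = y * (m + l * w) - (b - c) * w"
    and D: "D = l + m * w - (b - c) * y"
    and r: "r = m * D + k * x * N + (a - c) * N"
    and s: "s = (a - c) * x * D + k * D + m * x * N"
    and K: "K = (m + l * w) * (l + m * w) - (b - c)\<^sup>2 * w"
  shows "(a - b) * z2 * r * E + S * (l * r + k * w * s)
      = K * ((a - c) * z2 * n + m * n + k * w * d)"
    and "(a - b) * y1 * S * s + (k * r + l * w * s) * E
      = K * ((a - c) * y1 * d + k * n + m * w * d)"
    and "N * (l * r + k * w * s) - (a - b) * w * r * D
      = K * (y * (m * n + k * w * d) - (a - c) * w * n)"
    and "D * (k * r + l * w * s) - (a - b) * N * s
      = K * (k * n + m * w * d - (a - c) * y * d)"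
  using par unfolding r s N D n d S E w K by algebra+

lemma ratio_cancel:
  fixes p q r s t :: "'a::field"
  assumes "p = t * r" "q = t * s" "q \<noteq> 0" shows "p / q = r / s"
  using assms by auto

text \<open>
  Here two transformations on the left side meet a single one on the right. By
  \<open>product_23_12\<close> the two denominators of the last step on the left, \<open>P23\<close> and \<open>Q23\<close>, are, up to
  nonzero factors, multiples of \<open>det M12\<close>, so that \<open>ratio_cancel\<close> applies.
\<close>

lemma first_vertex_consistent:
  fixes a b c k l m x y w v P V T :: "'a::field"
  assumes par: "k\<^sup>2 - a\<^sup>2 = 1" "l\<^sup>2 - b\<^sup>2 = 1" "m\<^sup>2 - c\<^sup>2 = 1"
    and P: "P = P_fun (a - b) k l x y" "P \<noteq> 0"
    and V: "V = q2_fun (a - c) k m (w / P) (y / P)" "k + m * (w / P) - (a - c) * (y / P) \<noteq> 0"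
    and T: "T = q2_fun (b - c) l m w y" "l + m * w - (b - c) * y \<noteq> 0"
    and P23: "(b - c) * (x * P) + l + m * (x * P * V) \<noteq> 0"
    and Q12: "k + l * (x * y) - (a - b) * v \<noteq> 0"
    and Q23: "l + m * (x * P * V) - (b - c) * (q2_fun (a - b) k l (x * y) v) \<noteq> 0"
  shows "P * P_fun (b - c) l m (x * P) V = P_fun (a - c) k m x T"
    and "q2_fun (b - c) l m (x * P * V) (q2_fun (a - b) k l (x * y) v)
        = q2_fun (a - c) k m (x * T) v"
proof -
  define n where "n = (a - b) * y + l + k * (x * y)"
  define d where "d = (a - b) * x + k + l * (x * y)"
  define n2 where "n2 = v * (l + k * (x * y)) - (a - b) * (x * y)"
  define d2 where "d2 = k + l * (x * y) - (a - b) * v"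
  define N' where "N' = y * (m * n + k * w * d) - (a - c) * w * n"
  define D' where "D' = k * n + m * w * d - (a - c) * y * d"
  define N where "N = y * (m + l * w) - (b - c) * w"
  define D where "D = l + m * w - (b - c) * y"
  note A = product_23_12[OF par n_def d_def N'_def D'_def N_def D_def refl]
  have Pnd: "P = n / d" unfolding P(1) P_fun_def n_def d_def ..
  have d0: "d \<noteq> 0" and n0: "n \<noteq> 0" using P(2) Pnd by auto
  have d20: "d2 \<noteq> 0" using Q12 d2_def by simp
  have D0: "D \<noteq> 0" using T(2) D_def by simp
  have TND: "T = N / D" unfolding T(1) q2_fun_def N_def D_def ..
  have D': "D' = n * (k + m * (w / P) - (a - c) * (y / P))"
    unfolding Pnd D'_def using d0 n0 by (simp add: field_simps)
  then have D'0: "D' \<noteq> 0" using n0 V(2) by simp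
  have N': "N' = n * P * (y / P * (m + k * (w / P)) - (a - c) * (w / P))"
    unfolding Pnd N'_def using d0 n0 by (simp add: field_simps)
  have PV: "P * V = N' / D'" unfolding V(1) q2_fun_def D' N' using n0 P(2) V(2) by simp
  have Qnd: "q2_fun (a - b) k l (x * y) v = n2 / d2" unfolding q2_fun_def n2_def d2_def ..
  have xPV: "x * P * V = x * (N' / D')" using PV by (simp add: mult.assoc)
  show "P * P_fun (b - c) l m (x * P) V = P_fun (a - c) k m x T"
  proof -
    have den: "(b - c) * x * D' * n + (l * D' + m * x * N') * d
        = D' * d * ((b - c) * (x * P) + l + m * (x * P * V))"
      unfolding xPV unfolding Pnd using d0 D'0 by (simp add: field_simps)
    have "(m * D' + l * x * N') * n + (b - c) * N' * d
        = D' * d * ((b - c) * (P * V) + P * (m + l * (x * P * V)))"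
      unfolding xPV PV unfolding Pnd using d0 D'0 by (simp add: field_simps)
    also have "\<dots> = D' * d * (P * ((b - c) * V + m + l * (x * P * V)))"
      by (simp add: algebra_simps)
    finally have num: "(m * D' + l * x * N') * n + (b - c) * N' * d = \<dots>" .
    have "P * P_fun (b - c) l m (x * P) V
        = ((m * D' + l * x * N') * n + (b - c) * N' * d)
            / ((b - c) * x * D' * n + (l * D' + m * x * N') * d)"
      unfolding num den P_fun_def using d0 D'0 by simp
    also have "\<dots> = (m * D + k * x * N + (a - c) * N) / ((a - c) * x * D + k * D + m * x * N)"
      by (rule ratio_cancel[OF A(1) A(2)])
         (use d0 D'0 P23 den in simp)
    also have "\<dots> = (D * ((a - c) * T + m + k * (x * T))) / (D * ((a - c) * x + k + m * (x * T)))"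
      unfolding TND using D0 by (intro arg_cong2[where f = "(/)"]) (simp_all add: field_simps)
    also have "\<dots> = P_fun (a - c) k m x T" unfolding P_fun_def using D0 by simp
    finally show ?thesis .
  qed
  show "q2_fun (b - c) l m (x * P * V) (q2_fun (a - b) k l (x * y) v)
      = q2_fun (a - c) k m (x * T) v"
  proof -
    have den: "(l * D' + m * x * N') * d2 - (b - c) * D' * n2
        = D' * d2 * (l + m * (x * P * V) - (b - c) * (n2 / d2))"
      unfolding xPV using d20 D'0 by (simp add: field_simps)
    have num: "(m * D' + l * x * N') * n2 - (b - c) * x * N' * d2
        = D' * d2 * (n2 / d2 * (m + l * (x * P * V)) - (b - c) * (x * P * V))"
      unfolding xPV using d20 D'0 by (simp add: field_simps)
    have "q2_fun (b - c) l m (x * P * V) (n2 / d2)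
        = ((m * D' + l * x * N') * n2 - (b - c) * x * N' * d2)
            / ((l * D' + m * x * N') * d2 - (b - c) * D' * n2)"
      unfolding num den q2_fun_def using d20 D'0 by simp
    also have "\<dots> = (v * (m * D + k * x * N) - (a - c) * x * N)
        / (k * D + m * x * N - (a - c) * D * v)"
      by (rule ratio_cancel[OF A(3)[of v, folded n2_def d2_def] A(4)[of v, folded n2_def d2_def]])
         (use d20 D'0 Q23 den Qnd in simp)
    also have "\<dots> = (D * (v * (m + k * (x * T)) - (a - c) * (x * T)))
        / (D * (k + m * (x * T) - (a - c) * v))"
      unfolding TND using D0 by (intro arg_cong2[where f = "(/)"]) (simp_all add: field_simps)
    also have "\<dots> = q2_fun (a - c) k m (x * T) v" unfolding q2_fun_def using D0 by simp
    finally show ?thesis unfolding Qnd .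
  qed
qed

text \<open>
  Here two transformations on the right side meet a single one on the left, and it is the
  denominators \<open>P12\<close> and \<open>Q12\<close> of the last step of the right side that are, up to nonzero
  factors, multiples of \<open>det M23\<close>.
\<close>

lemma second_vertex_consistent:
  fixes a b c k l m x y y1 z2 w P S T U V :: "'a::field"
  assumes par: "k\<^sup>2 - a\<^sup>2 = 1" "l\<^sup>2 - b\<^sup>2 = 1" "m\<^sup>2 - c\<^sup>2 = 1"
    and w: "w = y1 * z2"
    and P: "P = P_fun (a - b) k l x y" "P \<noteq> 0"
    and V: "V = q2_fun (a - c) k m (w / P) (y / P)"
    and S: "S = P_fun (b - c) l m y1 z2" "S \<noteq> 0"
    and T: "T = q2_fun (b - c) l m w y" "l + m * w - (b - c) * y \<noteq> 0"
    and U: "U = P_fun (a - c) k m x T" "U \<noteq> 0"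
    and P12: "(a - b) * (y1 * S / U) + k + l * (w / U) \<noteq> 0"
    and Q12: "k + l * (w / U) - (a - b) * (T / U) \<noteq> 0"
  shows "P_fun (a - c) k m (y1 / P) z2 = S * P_fun (a - b) k l (y1 * S / U) (z2 / S)"
    and "P * V = U * q2_fun (a - b) k l (w / U) (T / U)"
proof -
  define n where "n = (a - b) * y + l + k * (x * y)"
  define d where "d = (a - b) * x + k + l * (x * y)"
  define M where "M = (b - c) * z2 + m + l * w"
  define E where "E = (b - c) * y1 + l + m * w"
  define N where "N = y * (m + l * w) - (b - c) * w"
  define D where "D = l + m * w - (b - c) * y"
  define r where "r = m * D + k * x * N + (a - c) * N"
  define s where "s = (a - c) * x * D + k * D + m * x * N"
  note B = product_12_23[OF par w n_def d_def M_def E_def N_def D_def r_def s_def refl]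
  have Pnd: "P = n / d" unfolding P(1) P_fun_def n_def d_def ..
  have d0: "d \<noteq> 0" and n0: "n \<noteq> 0" using P(2) Pnd by auto
  have SME: "S = M / E" unfolding S(1) P_fun_def M_def E_def w ..
  have E0: "E \<noteq> 0" and M0: "M \<noteq> 0" using S(2) SME by auto
  have D0: "D \<noteq> 0" using T(2) D_def by simp
  have TND: "T = N / D" unfolding T(1) q2_fun_def N_def D_def ..
  have r: "r = D * ((a - c) * T + m + k * (x * T))"
   and s: "s = D * ((a - c) * x + k + m * (x * T))"
    unfolding r_def s_def TND using D0 by (simp_all add: field_simps)
  have Urs: "U = r / s" unfolding U(1) P_fun_def r s using D0 by simp
  have r0: "r \<noteq> 0" and s0: "s \<noteq> 0" using U(2) Urs by auto
  show "P_fun (a - c) k m (y1 / P) z2 = S * P_fun (a - b) k l (y1 * S / U) (z2 / S)"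
  proof -
    have num: "(a - b) * z2 * r * E + M * (l * r + k * w * s)
        = r * E * (S * ((a - b) * (z2 / S) + l + k * (w / U)))"
      unfolding SME Urs using E0 M0 r0 s0 by (simp add: field_simps)
    have den: "(a - b) * y1 * M * s + (k * r + l * w * s) * E
        = r * E * ((a - b) * (y1 * S / U) + k + l * (w / U))"
      unfolding SME Urs using E0 M0 r0 s0 by (simp add: field_simps)
    have "S * P_fun (a - b) k l (y1 * S / U) (z2 / S)
        = ((a - b) * z2 * r * E + M * (l * r + k * w * s))
            / ((a - b) * y1 * M * s + (k * r + l * w * s) * E)"
      unfolding num den P_fun_def using r0 E0 S(2) by (simp add: w)
    also have "\<dots> = ((a - c) * z2 * n + m * n + k * w * d) / ((a - c) * y1 * d + k * n + m * w * d)"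
      by (rule ratio_cancel[OF B(1,2)]) (use r0 E0 P12 den in simp)
    also have "\<dots> = (n * ((a - c) * z2 + m + k * (y1 / P * z2)))
        / (n * ((a - c) * (y1 / P) + k + m * (y1 / P * z2)))"
      unfolding Pnd w using n0 d0 by (intro arg_cong2[where f = "(/)"]) (simp_all add: field_simps)
    also have "\<dots> = P_fun (a - c) k m (y1 / P) z2" unfolding P_fun_def using n0 by simp
    finally show ?thesis ..
  qed
  show "P * V = U * q2_fun (a - b) k l (w / U) (T / U)"
  proof -
    have num: "N * (l * r + k * w * s) - (a - b) * w * r * D
        = r * D * (U * (T / U * (l + k * (w / U)) - (a - b) * (w / U)))"
      unfolding TND Urs using D0 r0 s0 by (simp add: field_simps)
    have den: "D * (k * r + l * w * s) - (a - b) * N * s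
        = r * D * (k + l * (w / U) - (a - b) * (T / U))"
      unfolding TND Urs using D0 r0 s0 by (simp add: field_simps)
    have "U * q2_fun (a - b) k l (w / U) (T / U)
        = (N * (l * r + k * w * s) - (a - b) * w * r * D)
            / (D * (k * r + l * w * s) - (a - b) * N * s)"
      unfolding num den q2_fun_def using r0 D0 by simp
    also have "\<dots> = (y * (m * n + k * w * d) - (a - c) * w * n)
        / (k * n + m * w * d - (a - c) * y * d)"
      by (rule ratio_cancel[OF B(3,4)]) (use r0 D0 Q12 den in simp)
    also have "\<dots> = (n * (P * (y / P * (m + k * (w / P)) - (a - c) * (w / P))))
        / (n * (k + m * (w / P) - (a - c) * (y / P)))"
      unfolding Pnd using n0 d0 by (intro arg_cong2[where f = "(/)"]) (simp_all add: field_simps)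
    also have "\<dots> = P * V" unfolding V q2_fun_def using n0 by simp
    finally show ?thesis ..
  qed
qed

text \<open>Written in terms of the multipliers of the single steps, the components of the two results
  differ only in quantities that \<open>first_vertex_consistent\<close> and \<open>second_vertex_consistent\<close>
  identify.\<close>

lemma YB_sides_agree:
  assumes adm: "k\<^sup>2 - a\<^sup>2 = 1" "l\<^sup>2 - b\<^sup>2 = 1" "m\<^sup>2 - c\<^sup>2 = 1"
    and L: "YB_lhs (a, k) (b, l) (c, m) t = Some L" and R: "YB_rhs (a, k) (b, l) (c, m) t = Some R'"
  shows "L = R'"
proof -
  obtain x1 x2 y1 y2 z1 z2 where t: "t = ((x1, x2), (y1, y2), (z1, z2))" by (metis prod.exhaust)
  define P where "P = P_fun (a - b) k l x1 y2"
  define q where "q = q2_fun (a - b) k l (x1 * y2) x2"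
  define P' where "P' = P_fun (a - c) k m (y1 / P) z2"
  define V where "V = q2_fun (a - c) k m (y1 / P * z2) (y2 / P)"
  define P'' where "P'' = P_fun (b - c) l m (x1 * P) V"
  define S where "S = P_fun (b - c) l m y1 z2"
  define T where "T = q2_fun (b - c) l m (y1 * z2) y2"
  define U where "U = P_fun (a - c) k m x1 T"
  define S'' where "S'' = P_fun (a - b) k l (y1 * S / U) (z2 / S)"
  \<comment> \<open>\<open>P\<close>, \<open>P'\<close>, \<open>P''\<close> are the multipliers of the three steps of the left side, and \<open>S\<close>, \<open>U\<close>,
    \<open>S''\<close> those of the right side.\<close>
  obtain w1 w2 where w1: "on12 (R (a, k) (b, l)) t = Some w1"
    "on13 (R (a, k) (c, m)) w1 = Some w2" "on23 (R (b, l) (c, m)) w2 = Some L"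
    using L unfolding YB_lhs_def map_comp_Some_iff by blast
  obtain p1 p2 where p: "R (a, k) (b, l) ((x1, x2), (y1, y2)) = Some (p1, p2)"
    and "w1 = (p1, p2, (z1, z2))"
    using w1(1) by (auto simp: t on12_def)
  then obtain p3 p4 where p': "R (a, k) (c, m) (p1, (z1, z2)) = Some (p3, p4)"
    and "w2 = (p3, p2, p4)"
    using w1(2) by (auto simp: on13_def)
  then obtain p5 p6 where p'': "R (b, l) (c, m) (p2, p4) = Some (p5, p6)" and L': "L = (p3, p5, p6)"
    using w1(3) by (auto simp: on23_def)
  note 1 = R_SomeD[OF p P_def, folded q_def]
  have p12: "p1 = (y1 / P, y2 / P)" "p2 = (x1 * P, q)" using 1(1) by simp_all
  note 2 = R_SomeD[OF p'[unfolded p12] P'_def, folded V_def]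
  have p34: "p3 = (z1 / P', z2 / P')" "p4 = (y1 / P * P', V)" using 2(1) by simp_all
  note 3 = R_SomeD[OF p''[unfolded p12 p34] P''_def]
  have p56: "p5 = (y1 / P * P' / P'', V / P'')" "p6
      = (x1 * P * P'', q2_fun (b - c) l m (x1 * P * V) q)"
    using 3(1) by simp_all
  obtain w3 w4 where w3: "on23 (R (b, l) (c, m)) t = Some w3"
    "on13 (R (a, k) (c, m)) w3 = Some w4" "on12 (R (a, k) (b, l)) w4 = Some R'"
    using R unfolding YB_rhs_def map_comp_Some_iff by blast
  obtain s1 s2 where s: "R (b, l) (c, m) ((y1, y2), (z1, z2)) = Some (s1, s2)"
    and "w3 = ((x1, x2), s1, s2)"
    using w3(1) by (auto simp: t on23_def)
  then obtain s3 s4 where s': "R (a, k) (c, m) ((x1, x2), s2) = Some (s3, s4)"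
    and "w4 = (s3, s1, s4)"
    using w3(2) by (auto simp: on13_def)
  then obtain s5 s6 where s'': "R (a, k) (b, l) (s3, s1) = Some (s5, s6)" and R': "R'
      = (s5, s6, s4)"
    using w3(3) by (auto simp: on12_def)
  note 4 = R_SomeD[OF s S_def, folded T_def]
  have s12: "s1 = (z1 / S, z2 / S)" "s2 = (y1 * S, T)" using 4(1) by simp_all
  note 5 = R_SomeD[OF s'[unfolded s12] U_def]
  have s34: "s3 = (y1 * S / U, T / U)" "s4 = (x1 * U, q2_fun (a - c) k m (x1 * T) x2)"
      using 5(1) by simp_all
  note 6 = R_SomeD[OF s''[unfolded s12 s34] S''_def]
  have w: "y1 / P * z2 = y1 * z2 / P" "y1 * S / U * (z2 / S) = y1 * z2 / U" using 4(2) by simp_all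
  have s56: "s5 = (z1 / S / S'', z2 / S / S'')" "s6
      = (y1 * S / U * S'', q2_fun (a - b) k l (y1 * z2 / U) (T / U))"
    using 6(1) w(2) by simp_all
  have V: "V = q2_fun (a - c) k m (y1 * z2 / P) (y2 / P)" unfolding V_def w ..
  have U: "P * P'' = U" and q': "q2_fun (b - c) l m (x1 * P * V) q = q2_fun (a - c) k m (x1 * T) x2"
    unfolding P''_def q_def U_def
    by (rule first_vertex_consistent[OF adm P_def 1(2) V _ T_def];
        use 1 2 3 4 w in \<open>simp add: q_def\<close>)+
  have "P' = S * S''" and "P * V = U * q2_fun (a - b) k l (y1 * z2 / U) (T / U)"
    unfolding P'_def S''_def
    by (rule second_vertex_consistent[OF adm refl P_def 1(2) V S_def 4(2) T_def _ U_def 5(2)];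
        use 4 6 w in simp)+
  moreover have "V / P'' = q2_fun (a - b) k l (y1 * z2 / U) (T / U)"
  proof -
    have "P * V = P * (P'' * q2_fun (a - b) k l (y1 * z2 / U) (T / U))"
      using calculation(2) by (simp add: U[symmetric] mult.assoc)
    then show ?thesis using 1(2) 3(2) by simp
  qed
  moreover have "y1 / P * P' / P'' = y1 * P' / U" unfolding U[symmetric] by simp
  ultimately show ?thesis
    unfolding L' R' p34 p56 s34 s56 using q' U by (simp add: mult.assoc)
qed

section \<open>Open dense sets and generically injective partial maps\<close>

lemma dense_iff_meets_open:
  fixes U :: "'a::topological_space set"
  shows "closure U = UNIV \<longleftrightarrow> (\<forall>V. open V \<and> V \<noteq> {} \<longrightarrow> U \<inter> V \<noteq> {})"
proof
  assume "closure U = UNIV"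
  then show "\<forall>V. open V \<and> V \<noteq> {} \<longrightarrow> U \<inter> V \<noteq> {}"
    using open_Int_closure_eq_empty[of _ U] by (metis Int_UNIV_right Int_commute)
next
  assume meets: "\<forall>V. open V \<and> V \<noteq> {} \<longrightarrow> U \<inter> V \<noteq> {}"
  have "U \<inter> - closure U = {}" using closure_subset[of U] by blast
  then have "- closure U = {}" using meets by (metis open_Compl closed_closure)
  then show "closure U = UNIV" by blast
qed

lemma open_dense_Int:
  fixes U V :: "'a::topological_space set"
  assumes "open U" "closure U = UNIV" "open V" "closure V = UNIV"
  shows "open (U \<inter> V)" "closure (U \<inter> V) = UNIV"
  using assms unfolding dense_iff_meets_open by (auto simp: Int_assoc open_Int)

text \<open>A substitute for polynomials in several variables: being polynomial along every real line is
  inherited by sums and products, and it makes the nonvanishing set dense once it is nonempty.\<close>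

definition polynomial_on_lines :: "('v::real_vector \<Rightarrow> complex) \<Rightarrow> bool" where
  "polynomial_on_lines g \<longleftrightarrow> (\<forall>t h. \<exists>p. \<forall>r. g (t + r *\<^sub>R h) = poly p (of_real r))"

named_theorems poly_lines

lemma polynomial_on_lines_const [poly_lines]: "polynomial_on_lines (\<lambda>_. c)"
  unfolding polynomial_on_lines_def by (intro allI exI[of _ "[:c:]"]) simp

lemma polynomial_on_lines_linear:
  assumes "linear g" shows "polynomial_on_lines g"
  unfolding polynomial_on_lines_def
proof (intro allI)
  fix t h
  have "\<forall>r. g (t + r *\<^sub>R h) = poly [:g t, g h:] (of_real r)"
    using linear_add[OF assms] linear_scale[OF assms] by (simp add: scaleR_conv_of_real)
  then show "\<exists>p. \<forall>r. g (t + r *\<^sub>R h) = poly p (of_real r)" by blast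
qed

lemma polynomial_on_lines_coordinates [poly_lines]:
  "polynomial_on_lines (\<lambda>t :: point \<times> point. fst (fst t))"
  "polynomial_on_lines (\<lambda>t :: point \<times> point. snd (fst t))"
  "polynomial_on_lines (\<lambda>t :: point \<times> point. snd (snd t))"
  by (auto intro!: polynomial_on_lines_linear linearI)

lemma polynomial_on_lines_arith [poly_lines]:
  assumes "polynomial_on_lines f" "polynomial_on_lines g"
  shows "polynomial_on_lines (\<lambda>t. f t + g t)" "polynomial_on_lines (\<lambda>t. f t - g t)"
    "polynomial_on_lines (\<lambda>t. f t * g t)"
  using assms unfolding polynomial_on_lines_def by (metis poly_add poly_diff poly_mult)+

text \<open>On the line through a given point and \<open>t0\<close> the function is a nonzero polynomial, so it has only
  finitely many zeros there and is nonzero arbitrarily close to the given point.\<close>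

lemma nonzero_set_open_dense:
  fixes g :: "'v::real_normed_vector \<Rightarrow> complex"
  assumes "polynomial_on_lines g" "continuous_on UNIV g" "g t0 \<noteq> 0"
  shows "open {t. g t \<noteq> 0}" "closure {t. g t \<noteq> 0} = UNIV"
proof -
  show "open {t. g t \<noteq> 0}"
    using assms(2) by (intro open_Collect_neq continuous_intros)
  have "t \<in> closure {t. g t \<noteq> 0}" for t
    unfolding closure_approachable
  proof (intro allI impI)
    fix e :: real assume "e > 0"
    define h where "h = t0 - t"
    define \<delta> where "\<delta> = e / (norm h + 1)"
    have "\<delta> > 0" using \<open>e > 0\<close> by (simp add: \<delta>_def add_nonneg_pos)
    obtain p where p: "\<And>r. g (t + r *\<^sub>R h) = poly p (of_real r)"
      using assms(1) unfolding polynomial_on_lines_def by blast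
    have "p \<noteq> 0" using p[of 1] assms(3) by (auto simp: h_def)
    then have "finite (complex_of_real -` {z. poly p z = 0})"
      by (intro finite_vimageI poly_roots_finite inj_of_real)
    then have "infinite ({0<..<\<delta>} - complex_of_real -` {z. poly p z = 0})"
      using infinite_Ioo[OF \<open>\<delta> > 0\<close>] by (intro Diff_infinite_finite)
    then have "{0<..<\<delta>} - complex_of_real -` {z. poly p z = 0} \<noteq> {}"
      by (rule infinite_imp_nonempty)
    then obtain r where "r \<in> {0<..<\<delta>} - complex_of_real -` {z. poly p z = 0}" by blast
    then have r: "0 < r" "r < \<delta>" "poly p (complex_of_real r) \<noteq> 0" by simp_all
    have "r * norm h \<le> r * (norm h + 1)" using r by simp
    also have "\<dots> < e" using r(2) by (simp add: \<delta>_def pos_less_divide_eq add_nonneg_pos)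
    finally have "dist (t + r *\<^sub>R h) t < e" using r(1) by (simp add: dist_norm)
    then show "\<exists>s\<in>{t. g t \<noteq> 0}. dist s t < e"
      using p r(3) by (intro bexI[of _ "t + r *\<^sub>R h"]) simp_all
  qed
  then show "closure {t. g t \<noteq> 0} = UNIV" by blast
qed

text \<open>Injectivity is asked for on some open dense part of the domain only, because \<open>R\<close> is not
  injective where the determinant of its matrices vanishes. The conditions on the whole domain are what
  makes the domain of a composite open.\<close>

definition generic_embedding :: "('v::euclidean_space \<rightharpoonup> 'v) \<Rightarrow> bool" where
  "generic_embedding f \<longleftrightarrow> open (dom f) \<and> continuous_on (dom f) (the \<circ> f) \<and>
     (\<exists>U \<subseteq> dom f. open U \<and> closure U = UNIV \<and> inj_on (the \<circ> f) U)"

lemma generic_embedding_dom: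
  assumes "generic_embedding f" shows "open (dom f)" "closure (dom f) = UNIV"
proof -
  obtain U where U: "open (dom f)" "U \<subseteq> dom f" "closure U = UNIV"
    using assms unfolding generic_embedding_def by blast
  show "open (dom f)" by (rule U)
  show "closure (dom f) = UNIV" using closure_mono[OF U(2)] U(3) by blast
qed

lemma dom_map_comp_eq: "dom (f \<circ>\<^sub>m g) = dom g \<inter> (the \<circ> g) -` dom f"
  by (auto simp: map_comp_def dom_def split: option.splits)

text \<open>A nonempty open set meets the injectivity set \<open>W\<close> of \<open>g\<close> in a nonempty open set, whose image
  under \<open>g\<close> is open by invariance of domain and therefore meets the injectivity set \<open>U\<close> of \<open>f\<close>. So
  \<open>W \<inter> g\<^sup>-\<^sup>1 U\<close> is dense.\<close>

lemma generic_embedding_map_comp: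
  fixes f g :: "'v::euclidean_space \<rightharpoonup> 'v"
  assumes "generic_embedding f" "generic_embedding g"
  shows "generic_embedding (f \<circ>\<^sub>m g)"
proof -
  obtain U where f: "open (dom f)" "continuous_on (dom f) (the \<circ> f)"
    and U: "U \<subseteq> dom f" "open U" "closure U = UNIV" "inj_on (the \<circ> f) U"
    using assms(1) unfolding generic_embedding_def by blast
  obtain W where g: "open (dom g)" "continuous_on (dom g) (the \<circ> g)"
    and W: "W \<subseteq> dom g" "open W" "closure W = UNIV" "inj_on (the \<circ> g) W"
    using assms(2) unfolding generic_embedding_def by blast
  have val: "(the \<circ> (f \<circ>\<^sub>m g)) t = ((the \<circ> f) \<circ> (the \<circ> g)) t" if "t \<in> dom g" for t
    using that by (auto simp: map_comp_def)
  have gW: "continuous_on W (the \<circ> g)" using continuous_on_subset[OF g(2) W(1)] .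
  have "open (dom (f \<circ>\<^sub>m g))"
    unfolding dom_map_comp_eq using g f(1) by (intro continuous_open_preimage)
  moreover have "continuous_on (dom (f \<circ>\<^sub>m g)) (the \<circ> (f \<circ>\<^sub>m g))"
  proof (subst continuous_on_cong[OF refl val])
    show "continuous_on (dom (f \<circ>\<^sub>m g)) ((the \<circ> f) \<circ> (the \<circ> g))"
      unfolding dom_map_comp_eq
      by (intro continuous_on_compose continuous_on_subset[OF g(2)]
          continuous_on_subset[OF f(2)]) auto
  qed (auto simp: dom_map_comp_eq)
  moreover have "open (W \<inter> (the \<circ> g) -` U)"
    using gW W(2) U(2) by (intro continuous_open_preimage)
  moreover have "closure (W \<inter> (the \<circ> g) -` U) = UNIV"
    unfolding dense_iff_meets_open
  proof (intro allI impI)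
    fix V :: "'v set" assume V: "open V \<and> V \<noteq> {}"
    then have "open (W \<inter> V)" "W \<inter> V \<noteq> {}"
      using W(2,3) unfolding dense_iff_meets_open by auto
    then have "open ((the \<circ> g) ` (W \<inter> V))" "(the \<circ> g) ` (W \<inter> V) \<noteq> {}"
      using gW W(4) by (auto intro!: invariance_of_domain
        elim: continuous_on_subset inj_on_subset simp del: comp_apply)
    then have "U \<inter> (the \<circ> g) ` (W \<inter> V) \<noteq> {}"
      using U(3) unfolding dense_iff_meets_open by blast
    then show "W \<inter> (the \<circ> g) -` U \<inter> V \<noteq> {}" by blast
  qed
  moreover have "inj_on (the \<circ> (f \<circ>\<^sub>m g)) (W \<inter> (the \<circ> g) -` U)"
  proof (subst inj_on_cong[OF val])
    show "inj_on ((the \<circ> f) \<circ> (the \<circ> g)) (W \<inter> (the \<circ> g) -` U)"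
      by (intro comp_inj_on inj_on_subset[OF W(4)] inj_on_subset[OF U(4)]) auto
  qed (use W(1) in auto)
  moreover have "W \<inter> (the \<circ> g) -` U \<subseteq> dom (f \<circ>\<^sub>m g)"
    unfolding dom_map_comp_eq using U(1) W(1) by auto
  ultimately show ?thesis unfolding generic_embedding_def by blast
qed

lemma generic_embedding_total:
  fixes \<sigma> :: "'v::euclidean_space \<Rightarrow> 'v"
  assumes "continuous_on UNIV \<sigma>" "inj \<sigma>"
  shows "generic_embedding (Some \<circ> \<sigma>)"
proof -
  have "the \<circ> (Some \<circ> \<sigma>) = \<sigma>" "dom (Some \<circ> \<sigma>) = UNIV" by auto
  then show ?thesis
    unfolding generic_embedding_def using assms by (intro conjI exI[of _ UNIV]) auto
qed

text \<open>For the last two entries the domain is a product set. The other two positions are conjugate to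
  this one by a permutation of the entries.\<close>

lemma generic_embedding_on23:
  assumes "generic_embedding f" shows "generic_embedding (on23 f)"
proof -
  obtain U where f: "open (dom f)" "continuous_on (dom f) (the \<circ> f)"
    and U: "U \<subseteq> dom f" "open U" "closure U = UNIV" "inj_on (the \<circ> f) U"
    using assms(1) unfolding generic_embedding_def by blast
  have dom: "dom (on23 f) = UNIV \<times> dom f"
    by (auto simp: on23_def dom_def)
  have val: "(the \<circ> on23 f) t = (fst t, (the \<circ> f) (snd t))" if "t \<in> UNIV \<times> dom f" for t
    using that by (auto simp: on23_def)
  have "continuous_on (UNIV \<times> dom f) (the \<circ> on23 f)"
    by (subst continuous_on_cong[OF refl val])
        (auto intro!: continuous_intros continuous_on_compose2[OF f(2)] simp del: comp_apply)
  moreover have "inj_on (the \<circ> on23 f) (UNIV \<times> U)"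
    by (subst inj_on_cong[OF val]) (use U(1,4) in \<open>auto simp: inj_on_def simp del: comp_apply\<close>)
  moreover have "closure (UNIV \<times> U :: (point \<times> point \<times> point) set) = UNIV"
    using U(3) by (simp add: closure_Times)
  ultimately show ?thesis
    unfolding generic_embedding_def dom using f(1) U(1,2)
    by (intro conjI exI[of _ "UNIV \<times> U"]) (auto intro: open_Times)
qed

lemma generic_embedding_on12:
  assumes "generic_embedding f" shows "generic_embedding (on12 f)"
proof -
  have "on12 f = (Some \<circ> (\<lambda>(z, x, y). (x, y, z))) \<circ>\<^sub>m (on23 f \<circ>\<^sub>m (Some \<circ> (\<lambda>(x, y, z). (z, x, y))))"
    by (rule ext) (simp add: on12_def on23_def map_comp_def case_prod_unfold split: option.split)
  moreover have "generic_embedding (Some \<circ> (\<lambda>(z :: point, x :: point, y :: point). (x, y, z)))"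
    by (rule generic_embedding_total)
      (auto simp: case_prod_unfold inj_def prod_eq_iff intro!: continuous_intros)
  moreover have "generic_embedding (Some \<circ> (\<lambda>(x :: point, y :: point, z :: point). (z, x, y)))"
    by (rule generic_embedding_total)
      (auto simp: case_prod_unfold inj_def prod_eq_iff intro!: continuous_intros)
  ultimately show ?thesis
    using generic_embedding_map_comp generic_embedding_on23[OF assms] by metis
qed

lemma generic_embedding_on13:
  assumes "generic_embedding f" shows "generic_embedding (on13 f)"
proof -
  have "on13 f = (Some \<circ> (\<lambda>(y, x, z). (x, y, z))) \<circ>\<^sub>m (on23 f \<circ>\<^sub>m (Some \<circ> (\<lambda>(x, y, z). (y, x, z))))"
    by (rule ext) (simp add: on13_def on23_def map_comp_def case_prod_unfold split: option.split)
  moreover have "generic_embedding (Some \<circ> (\<lambda>(y :: point, x :: point, z :: point). (x, y, z)))"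
    by (rule generic_embedding_total)
      (auto simp: case_prod_unfold inj_def prod_eq_iff intro!: continuous_intros)
  moreover have "generic_embedding (Some \<circ> (\<lambda>(x :: point, y :: point, z :: point). (y, x, z)))"
    by (rule generic_embedding_total)
      (auto simp: case_prod_unfold inj_def prod_eq_iff intro!: continuous_intros)
  ultimately show ?thesis
    using generic_embedding_map_comp generic_embedding_on23[OF assms] by metis
qed

section \<open>The common domain\<close>

lemma moebius_inj:
  fixes p q r s z z' :: "'a::field"
  assumes "(p * z + q) / (r * z + s) = (p * z' + q) / (r * z' + s)"
    and "r * z + s \<noteq> 0" "r * z' + s \<noteq> 0" "p * s - q * r \<noteq> 0"
  shows "z = z'"
proof -
  have "(p * z + q) * (r * z' + s) = (p * z' + q) * (r * z + s)"
    using assms(1-3) by (simp add: frac_eq_eq)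
  then have "(p * s - q * r) * (z - z') = 0" by algebra
  then show ?thesis using assms(4) by simp
qed

text \<open>The product \<open>s = x\<^sup>1 y\<^sup>2\<close> equals \<open>q\<^sup>1 p\<^sup>2\<close> and can be read off from the image. Then \<open>x\<^sup>1\<close> and
  \<open>x\<^sup>2\<close> are recovered by inverting Moebius transformations with known matrices, and \<open>P\<close>, hence
  \<open>y\<close>, from the quotient of \<open>q\<^sup>1\<close> by \<open>x\<^sup>1\<close>.\<close>

lemma R_injective:
  assumes "R (a, k) (b, l) ((x1, x2), (y1, y2)) = Some t"
    and "R (a, k) (b, l) ((x1', x2'), (y1', y2')) = Some t"
    and "x1 \<noteq> 0" "(l + k * (x1 * y2)) * (k + l * (x1 * y2)) - (a - b)\<^sup>2 * (x1 * y2) \<noteq> 0"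
  shows "((x1, x2), (y1, y2)) = ((x1', x2'), (y1', y2'))"
proof -
  define P where "P = P_fun (a - b) k l x1 y2"
  define P' where "P' = P_fun (a - b) k l x1' y2'"
  define s where "s = x1 * y2"
  have nz: "P \<noteq> 0" "P' \<noteq> 0" "(a - b) * x1 + k + l * s \<noteq> 0" "(a - b) * x1' + k + l * (x1' * y2') \<noteq> 0"
     "k + l * s - (a - b) * x2 \<noteq> 0" "k + l * (x1' * y2') - (a - b) * x2' \<noteq> 0"
    and eq: "y1 / P = y1' / P'" "y2 / P = y2' / P'" "x1 * P = x1' * P'"
      "q2_fun (a - b) k l s x2 = q2_fun (a - b) k l (x1' * y2') x2'"
    using assms(1,2) unfolding R_eq Let_def P_def P'_def s_def by (auto split: if_splits)
  have s': "x1' * y2' = s" using eq(2,3) nz(1,2) unfolding s_def by (simp add: field_simps) algebra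
  have det: "(l + k * s) * (k + l * s) - (a - b) * s * (a - b) \<noteq> 0"
    using assms(4) unfolding s_def by (simp add: power2_eq_square algebra_simps)
  have "x1 * P = ((l + k * s) * x1 + (a - b) * s) / ((a - b) * x1 + (k + l * s))"
    unfolding P_def P_fun_def s_def by (simp add: algebra_simps)
  moreover have "x1' * P' = ((l + k * s) * x1' + (a - b) * s) / ((a - b) * x1' + (k + l * s))"
    unfolding P'_def P_fun_def s'[symmetric] by (simp add: algebra_simps)
  ultimately have "((l + k * s) * x1 + (a - b) * s) / ((a - b) * x1 + (k + l * s)) =
      ((l + k * s) * x1' + (a - b) * s) / ((a - b) * x1' + (k + l * s))"
    using eq(3) by simp
  then have x1: "x1 = x1'"
    by (rule moebius_inj) (use nz(3,4) det in \<open>simp_all only: s' add.assoc not_False_eq_True\<close>)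
  have "q2_fun (a - b) k l s z
      = ((l + k * s) * z + (- (a - b) * s)) / (- (a - b) * z + (k + l * s))" for z
    unfolding q2_fun_def by (simp add: algebra_simps)
  then have "((l + k * s) * x2 + (- (a - b) * s)) / (- (a - b) * x2 + (k + l * s)) =
      ((l + k * s) * x2' + (- (a - b) * s)) / (- (a - b) * x2' + (k + l * s))"
    using eq(4) unfolding s' by metis
  then have x2: "x2 = x2'"
    by (rule moebius_inj) (use nz(5,6) det in \<open>simp_all add: s' algebra_simps\<close>)
  have "P = P'" using eq(3) x1 assms(3) by simp
  then show ?thesis using x1 x2 eq(1,2) nz by simp
qed

text \<open>All conditions on a point are that some polynomial does not vanish there, so only one point of
  nonvanishing has to be exhibited for each of these polynomials.\<close>

lemma generic_embedding_R:
  assumes "admissible (a, k)" "admissible (b, l)" "nondegenerate (a, k) (b, l)"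
  shows "generic_embedding (R (a, k) (b, l))"
proof -
  define X1 :: "point \<times> point \<Rightarrow> complex" where "X1 = (\<lambda>t. fst (fst t))"
  define X2 :: "point \<times> point \<Rightarrow> complex" where "X2 = (\<lambda>t. snd (fst t))"
  define Y2 :: "point \<times> point \<Rightarrow> complex" where "Y2 = (\<lambda>t. snd (snd t))"
  define num where "num t = (a - b) * Y2 t + l + k * (X1 t * Y2 t)" for t
  define den where "den t = (a - b) * X1 t + k + l * (X1 t * Y2 t)" for t
  define qden where "qden t = k + l * (X1 t * Y2 t) - (a - b) * X2 t" for t
  define qnum where "qnum t = X2 t * (l + k * (X1 t * Y2 t)) - (a - b) * (X1 t * Y2 t)" for t
  define det where "det t
      = (l + k * (X1 t * Y2 t)) * (k + l * (X1 t * Y2 t)) - (a - b) * (a - b) * (X1 t * Y2 t)" for t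
  note defs = X1_def X2_def Y2_def num_def den_def qden_def qnum_def det_def
  have coords: "X1 ((x1, x2), (y1, y2)) = x1" "X2 ((x1, x2), (y1, y2)) = x2"
    "Y2 ((x1, x2), (y1, y2)) = y2"
    for x1 x2 y1 y2 by (simp_all add: defs)
  have adm: "k\<^sup>2 - a\<^sup>2 = 1" "l\<^sup>2 - b\<^sup>2 = 1" and nondeg: "\<not> (a = b \<and> k = 0 \<and> l = 0)"
    using assms by (simp_all add: admissible_def nondegenerate_def)
  have Rt: "R (a, k) (b, l) t =
      (if X2 t \<noteq> 0 \<and> den t \<noteq> 0 \<and> qden t \<noteq> 0 \<and> num t \<noteq> 0
       then Some ((fst (snd t) / (num t / den t), Y2 t / (num t / den t)),
          (X1 t * (num t / den t), qnum t / qden t)) else None)" for t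
    by (cases t; cases "fst t"; cases "snd t") (auto simp: R_eq P_fun_def q2_fun_def Let_def defs)
  have cont: "continuous_on A X1" "continuous_on A X2" "continuous_on A Y2"
     "continuous_on A num" "continuous_on A den" "continuous_on A qden"
     "continuous_on A qnum" "continuous_on A det" for A
    unfolding defs by (intro continuous_intros)+
  have pol: "polynomial_on_lines X1" "polynomial_on_lines X2"
     "polynomial_on_lines num" "polynomial_on_lines den"
     "polynomial_on_lines qden" "polynomial_on_lines det"
    unfolding defs by (intro poly_lines)+
  have dom: "dom (R (a, k) (b, l))
      = {t. X2 t \<noteq> 0} \<inter> {t. den t \<noteq> 0} \<inter> {t. qden t \<noteq> 0} \<inter> {t. num t \<noteq> 0}"
    unfolding dom_def Rt by auto
  have dom_open: "open (dom (R (a, k) (b, l)))"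
    unfolding dom using cont[of UNIV] by (intro open_Int open_Collect_neq continuous_on_const) auto
  have R_cont: "continuous_on (dom (R (a, k) (b, l))) (the \<circ> R (a, k) (b, l))"
  proof (subst continuous_on_cong[OF refl])
    show "(the \<circ> R (a, k) (b, l)) t = ((fst (snd t) / (num t / den t), Y2 t / (num t / den t)),
          (X1 t * (num t / den t), qnum t / qden t))"
      if "t \<in> dom (R (a, k) (b, l))" for t
      using that unfolding dom comp_apply Rt by simp
    show "continuous_on (dom (R (a, k) (b, l))) (\<lambda>t. ((fst (snd t) / (num t / den t), Y2 t / (num t / den t)),
          (X1 t * (num t / den t), qnum t / qden t)))"
      by (intro continuous_intros cont) (auto simp: dom)
  qed
  define U where "U = {t. X1 t \<noteq> 0} \<inter> ({t. det t \<noteq> 0} \<inter> ({t. X2 t \<noteq> 0}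
      \<inter> ({t. den t \<noteq> 0} \<inter> ({t. qden t \<noteq> 0} \<inter> {t. num t \<noteq> 0}))))"
  have "\<exists>t. den t \<noteq> 0"
  proof (cases "k = 0")
    case True
    then show ?thesis using nondeg
      by (intro exI[of _ "((1, 0), (0, if a = b then 1 else 0))"]) (auto simp: den_def coords)
  next
    case False
    then show ?thesis by (intro exI[of _ "((0, 0), (0, 0))"]) (simp add: den_def coords)
  qed
  moreover have "\<exists>t. num t \<noteq> 0"
  proof (cases "l = 0")
    case True
    then show ?thesis using nondeg
      by (intro exI[of _ "((if a = b then 1 else 0, 0), (0, 1))"]) (auto simp: num_def coords)
  next
    case False
    then show ?thesis by (intro exI[of _ "((0, 0), (0, 0))"]) (simp add: num_def coords)
  qed
  moreover have "\<exists>t. qden t \<noteq> 0"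
  proof (cases "k = 0")
    case True
    then show ?thesis using nondeg
      by (intro exI[of _ "if a = b then ((1, 0), (0, 1)) else ((0, 1), (0, 0))"])
          (auto simp: qden_def coords)
  next
    case False
    then show ?thesis by (intro exI[of _ "((0, 0), (0, 0))"]) (simp add: qden_def coords)
  qed
  moreover have "\<exists>t. det t \<noteq> 0"
  proof (rule ccontr)
    assume "\<not> ?thesis"
    \<comment> \<open>As a polynomial in \<open>s\<close> the determinant is \<open>k l (1 + s\<^sup>2) + 2 (1 + a b) s\<close>; the two points
      have \<open>s = 0\<close> and \<open>s = 1\<close>.\<close>
    then have "det ((0, 0), (0, 0)) = 0" "det ((1, 0), (0, 1)) = 0" by auto
    then have kl: "k * l = 0" and sq: "(l + k) * (k + l) - (a - b) * (a - b) = 0"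
      by (auto simp: det_def coords)
    have ab: "2 * (a * b + 1) = 0" using sq kl adm by algebra
    have ab: "a * b + 1 = 0" using ab by (metis mult_eq_0_iff zero_neq_numeral)
    have "k = 0 \<and> l = 0 \<and> a = b"
    proof (cases "k = 0")
      case True
      then have "a * (a - b) = 0" "a \<noteq> 0" using ab adm(1) by (auto) algebra+
      then have "a = b" by simp
      moreover have "l\<^sup>2 = 0" using True \<open>a = b\<close> adm by algebra
      ultimately show ?thesis using True by simp
    next
      case False
      then have l: "l = 0" using kl by simp
      then have "b * (a - b) = 0" "b \<noteq> 0" using ab adm(2) by (auto) algebra+
      then have "a = b" by simp
      moreover have "k\<^sup>2 = 0" using l \<open>a = b\<close> adm by algebra
      ultimately show ?thesis using l by simp
    qed
    then show False using nondeg by simp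
  qed
  moreover have "X1 ((1, 1), (0, 0)) \<noteq> 0" "X2 ((1, 1), (0, 0)) \<noteq> 0" by (simp_all add: coords)
  ultimately have ne: "\<exists>t. X1 t \<noteq> 0" "\<exists>t. X2 t \<noteq> 0" "\<exists>t. den t \<noteq> 0" "\<exists>t. num t \<noteq> 0"
    "\<exists>t. qden t \<noteq> 0" "\<exists>t. det t \<noteq> 0" by blast+
  have "open {t. g t \<noteq> 0} \<and> closure {t. g t \<noteq> 0} = UNIV"
    if "g \<in> {X1, X2, den, num, qden, det}" for g
    using that ne nonzero_set_open_dense[of g] pol cont[of UNIV] by blast
  then have U_dense: "open U \<and> closure U = UNIV"
    unfolding U_def by (intro conjI open_Int open_dense_Int) blast+
  have "inj_on (the \<circ> R (a, k) (b, l)) U"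
  proof (rule inj_onI)
    fix t t' assume t: "t \<in> U" "t' \<in> U" "(the \<circ> R (a, k) (b, l)) t = (the \<circ> R (a, k) (b, l)) t'"
    then obtain r where r: "R (a, k) (b, l) t = Some r" "R (a, k) (b, l) t' = Some r"
      unfolding U_def Rt by auto
    obtain x1 x2 y1 y2 where t1: "t = ((x1, x2), (y1, y2))"
      by (rule that[of "fst (fst t)" "snd (fst t)" "fst (snd t)" "snd (snd t)"]) simp
    obtain x1' x2' y1' y2' where t2: "t' = ((x1', x2'), (y1', y2'))"
      by (rule that[of "fst (fst t')" "snd (fst t')" "fst (snd t')" "snd (snd t')"]) simp
    note tt' = t1 t2
    show "t = t'"
      unfolding tt'
      by (rule R_injective[OF r[unfolded tt']])
          (use t(1) in \<open>auto simp: U_def tt' det_def coords power2_eq_square\<close>)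
  qed
  moreover have "U \<subseteq> dom (R (a, k) (b, l))" unfolding U_def dom by auto
  ultimately show ?thesis
    unfolding generic_embedding_def using dom_open R_cont U_dense by blast
qed

theorem mainTheorem10:
  fixes \<beta>1 \<gamma>1 \<beta>2 \<gamma>2 \<beta>3 \<gamma>3 :: complex
  assumes "admissible (\<beta>1, \<gamma>1)" and "admissible (\<beta>2, \<gamma>2)" and "admissible (\<beta>3, \<gamma>3)"
  shows
    "(\<forall>u v u1 u2 v2 u12 v12 :: complex.
        u \<noteq> 0 \<and> v \<noteq> 0 \<and> u1 \<noteq> 0 \<and> u12 \<noteq> 0 \<and>
        (\<beta>1 - \<beta>2) * u + \<gamma>1 * u1 + \<gamma>2 * v2 \<noteq> 0 \<and>
        (\<beta>2 - \<beta>1) * v + \<gamma>2 * v2 + \<gamma>1 * u1 \<noteq> 0 \<and>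
        u12 = ((\<beta>1 - \<beta>2) * u1 * v2 + u * (\<gamma>2 * u1 + \<gamma>1 * v2))
                / ((\<beta>1 - \<beta>2) * u + \<gamma>1 * u1 + \<gamma>2 * v2) \<and>
        v12 = ((\<beta>2 - \<beta>1) * u1 * v2 + v * (\<gamma>1 * v2 + \<gamma>2 * u1))
                / ((\<beta>2 - \<beta>1) * v + \<gamma>2 * v2 + \<gamma>1 * u1)
        \<longrightarrow> R (\<beta>1, \<gamma>1) (\<beta>2, \<gamma>2) ((u / u1, v / u1), (u2 / u, v2 / u))
              = Some ((u2 / u12, v2 / u12), (u12 / u1, v12 / u1)))
     \<and>
     (\<forall>t \<in> dom (YB_lhs (\<beta>1, \<gamma>1) (\<beta>2, \<gamma>2) (\<beta>3, \<gamma>3))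
            \<inter> dom (YB_rhs (\<beta>1, \<gamma>1) (\<beta>2, \<gamma>2) (\<beta>3, \<gamma>3)).
        YB_lhs (\<beta>1, \<gamma>1) (\<beta>2, \<gamma>2) (\<beta>3, \<gamma>3) t = YB_rhs (\<beta>1, \<gamma>1) (\<beta>2, \<gamma>2) (\<beta>3, \<gamma>3) t)
     \<and>
     (nondegenerate (\<beta>1, \<gamma>1) (\<beta>2, \<gamma>2) \<and> nondegenerate (\<beta>1, \<gamma>1) (\<beta>3, \<gamma>3)
        \<and> nondegenerate (\<beta>2, \<gamma>2) (\<beta>3, \<gamma>3)
      \<longrightarrow> open (dom (YB_lhs (\<beta>1, \<gamma>1) (\<beta>2, \<gamma>2) (\<beta>3, \<gamma>3))
                \<inter> dom (YB_rhs (\<beta>1, \<gamma>1) (\<beta>2, \<gamma>2) (\<beta>3, \<gamma>3)))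
          \<and> closure (dom (YB_lhs (\<beta>1, \<gamma>1) (\<beta>2, \<gamma>2) (\<beta>3, \<gamma>3))
                \<inter> dom (YB_rhs (\<beta>1, \<gamma>1) (\<beta>2, \<gamma>2) (\<beta>3, \<gamma>3))) = UNIV)"
proof -
  have adm: "\<gamma>1\<^sup>2 - \<beta>1\<^sup>2 = 1" "\<gamma>2\<^sup>2 - \<beta>2\<^sup>2 = 1" "\<gamma>3\<^sup>2 - \<beta>3\<^sup>2 = 1"
    using assms by (simp_all add: admissible_def)
  let ?L = "YB_lhs (\<beta>1, \<gamma>1) (\<beta>2, \<gamma>2) (\<beta>3, \<gamma>3)" and ?R = "YB_rhs (\<beta>1, \<gamma>1) (\<beta>2, \<gamma>2) (\<beta>3, \<gamma>3)"
  have agree: "\<forall>t \<in> dom ?L \<inter> dom ?R. ?L t = ?R t"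
    using YB_sides_agree[OF adm] by fastforce
  have dense: "open (dom ?L \<inter> dom ?R)" "closure (dom ?L \<inter> dom ?R) = UNIV"
    if "nondegenerate (\<beta>1, \<gamma>1) (\<beta>2, \<gamma>2)" "nondegenerate (\<beta>1, \<gamma>1) (\<beta>3, \<gamma>3)"
      "nondegenerate (\<beta>2, \<gamma>2) (\<beta>3, \<gamma>3)"
  proof -
    note gen = generic_embedding_R[OF assms(1,2) that(1)] generic_embedding_R[OF assms(1,3) that(2)]
      generic_embedding_R[OF assms(2,3) that(3)]
    have "generic_embedding ?L" "generic_embedding ?R"
      unfolding YB_lhs_def YB_rhs_def
      by (intro generic_embedding_map_comp generic_embedding_on12 generic_embedding_on13
          generic_embedding_on23 gen)+
    note both = generic_embedding_dom[OF this(1)] generic_embedding_dom[OF this(2)]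
    show "open (dom ?L \<inter> dom ?R)" by (rule open_dense_Int(1)[OF both])
    show "closure (dom ?L \<inter> dom ?R) = UNIV" by (rule open_dense_Int(2)[OF both])
  qed
  show ?thesis
    using agree dense by (intro conjI allI impI R_of_square) auto
qed

end
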